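(* Assume that $2^{\omega_1}=\mathfrak c$. Then there exist pseudocompact abelian topological groups $G$ and $H$ such that all closed subgroups of $G$ and all closed subgroups of $H$ are separable, but the product group $G\times H$ contains a closed non-separable $\sigma$-compact subgroup.
   Context: All topological groups are assumed to be Hausdorff. $\mathfrak c=2^{\omega}$ is the cardinality of the continuum and $\omega_1$ is the first uncountable cardinal. A Tychonoff space $X$ is pseudocompact if every continuous real-valued function on $X$ is bounded. A space is separable if it contains a countable dense subset; subgroups carry the subspace topology. A space is $\sigma$-compact if it is a countable union of compact subspaces. *)

theory Defs
  imports "HOL-Analysis.Analysis" "HOL-Algebra.Group"
begin

unbundle cardinal_syntax

text \<open>Topological groups are Hausdorff by convention. The topology is carried separately from the
  group record; its underlying space is required to be exactly the carrier.\<close>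

definition topological_group :: "('a, 'b) monoid_scheme \<Rightarrow> 'a topology \<Rightarrow> bool" where
  "topological_group G X \<longleftrightarrow>
     group G \<and> topspace X = carrier G \<and> Hausdorff_space X \<and>
     continuous_map (prod_topology X X) X (\<lambda>(x, y). x \<otimes>\<^bsub>G\<^esub> y) \<and>
     continuous_map X X (\<lambda>x. inv\<^bsub>G\<^esub> x)"

definition tychonoff_space :: "'a topology \<Rightarrow> bool" where
  "tychonoff_space X \<longleftrightarrow> completely_regular_space X \<and> Hausdorff_space X"

definition pseudocompact_space :: "'a topology \<Rightarrow> bool" where
  "pseudocompact_space X \<longleftrightarrow>
     tychonoff_space X \<and>
     (\<forall>f. continuous_map X euclideanreal f \<longrightarrow> bounded (f ` topspace X))"

definition sigma_compact_space :: "'a topology \<Rightarrow> bool" where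
  "sigma_compact_space X \<longleftrightarrow>
     (\<exists>\<K>. countable \<K> \<and> (\<forall>K\<in>\<K>. compactin X K) \<and> \<Union>\<K> = topspace X)"

end

theory Submission
  imports Defs
begin

text \<open>Take a set \<open>I\<close> of reals of cardinality \<open>\<omega>\<^sub>1\<close>, so that the Cantor group \<open>2^I\<close>, realised as \<open>Pow I\<close>
  under symmetric difference, has cardinality \<open>c\<close>. Its subgroup \<open>S\<close> of finite sets is
  \<open>\<sigma>\<close>-compact and not separable. Two subgroups \<open>G\<close> and \<open>H\<close> with \<open>G \<inter> H = S\<close> are chosen by transfinite
  recursion so that both meet each of \<open>c\<close> prescribed subsets of \<open>2^I\<close> of size \<open>c\<close>; independence of
  the chosen points modulo \<open>S\<close> keeps the intersection down to \<open>S\<close>. The diagonal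
  of \<open>S\<close> is then a closed subgroup of \<open>G \<times> H\<close>.

  The prescribed sets are of two kinds. The sets of all extensions of a point of \<open>2^J\<close>, for countable
  \<open>J\<close>, make \<open>G\<close> and \<open>H\<close> project onto all countable faces, hence pseudocompact. Moreover, every infinite
  closed subgroup \<open>N\<close> of \<open>2^I\<close> is homeomorphic to some \<open>2^J\<close> with \<open>J\<close> an infinite set of reals, and so has a
  countable \<open>\<pi>\<close>-network of sets of size \<open>c\<close>; meeting all of these makes \<open>G \<inter> N\<close> separable. There are
  only \<open>2^|I| = c\<close> closed subgroups \<open>N\<close>.\<close>

section \<open>The Cantor topology on a power set\<close>

text \<open>A set stands for its indicator function. For finite \<open>F\<close> these are the basic
  neighbourhoods of \<open>x\<close> in the product topology; infinite \<open>F\<close> occur later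
  as faces.\<close>

definition cylinder :: "'a set \<Rightarrow> 'a set \<Rightarrow> 'a set set" where
  "cylinder x F = {y. y \<inter> F = x \<inter> F}"

text \<open>The product topology of discrete two-point spaces, carried over to sets. It lives on the
  whole type; the cube \<open>Pow I\<close> enters only as a subset.\<close>

definition cantor_topology :: "'a set topology" where
  "cantor_topology = topology (\<lambda>U. \<forall>x\<in>U. \<exists>F. finite F \<and> cylinder x F \<subseteq> U)"

lemma cylinder_refl [simp]: "x \<in> cylinder x F"
  by (simp add: cylinder_def)

lemma cylinder_mono: "F \<subseteq> F' \<Longrightarrow> cylinder x F' \<subseteq> cylinder x F"
  by (auto simp: cylinder_def)

lemma cylinder_eq: "y \<in> cylinder x F \<Longrightarrow> cylinder y F = cylinder x F"
  by (auto simp: cylinder_def)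

lemma openin_cantor:
  "openin cantor_topology U \<longleftrightarrow> (\<forall>x\<in>U. \<exists>F. finite F \<and> cylinder x F \<subseteq> U)"
proof -
  have "istopology (\<lambda>U. \<forall>x\<in>U. \<exists>F. finite F \<and> cylinder x F \<subseteq> (U :: 'a set set))"
    unfolding istopology_def
  proof (intro conjI allI impI ballI)
    fix U V :: "'a set set" and x
    assume "\<forall>x\<in>U. \<exists>F. finite F \<and> cylinder x F \<subseteq> U" "\<forall>x\<in>V. \<exists>F. finite F \<and> cylinder x F \<subseteq> V"
      and x: "x \<in> U \<inter> V"
    then obtain F F' where "finite F" "cylinder x F \<subseteq> U" "finite F'" "cylinder x F' \<subseteq> V"
      by (metis IntE)
    then have "finite (F \<union> F') \<and> cylinder x (F \<union> F') \<subseteq> U \<inter> V"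
      using cylinder_mono [of F "F \<union> F'" x] cylinder_mono [of F' "F \<union> F'" x] by auto
    then show "\<exists>F. finite F \<and> cylinder x F \<subseteq> U \<inter> V" by blast
  next
    fix \<K> :: "'a set set set" and x
    assume *: "\<forall>U\<in>\<K>. \<forall>x\<in>U. \<exists>F. finite F \<and> cylinder x F \<subseteq> U" and "x \<in> \<Union>\<K>"
    then obtain U where "U \<in> \<K>" "x \<in> U" by blast
    moreover from this * obtain F where "finite F" "cylinder x F \<subseteq> U" by blast
    ultimately show "\<exists>F. finite F \<and> cylinder x F \<subseteq> \<Union>\<K>" by blast
  qed
  then show ?thesis by (simp add: cantor_topology_def)
qed

lemma topspace_cantor [simp]: "topspace cantor_topology = UNIV"
  using openin_cantor [of UNIV] openin_subset by fastforce

lemma openin_cylinder: "finite F \<Longrightarrow> openin cantor_topology (cylinder x F)"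
  by (metis cylinder_eq openin_cantor order_refl)

lemma closure_of_cantor:
  "cantor_topology closure_of C = {x. \<forall>F. finite F \<longrightarrow> (\<exists>c\<in>C. c \<in> cylinder x F)}"
proof (intro equalityI subsetI)
  fix x assume "x \<in> cantor_topology closure_of C"
  then show "x \<in> {x. \<forall>F. finite F \<longrightarrow> (\<exists>c\<in>C. c \<in> cylinder x F)}"
    by (simp add: in_closure_of) (meson cylinder_refl openin_cylinder)
next
  fix x assume x: "x \<in> {x. \<forall>F. finite F \<longrightarrow> (\<exists>c\<in>C. c \<in> cylinder x F)}"
  show "x \<in> cantor_topology closure_of C"
    unfolding in_closure_of
  proof (intro conjI allI impI)
    fix T assume "x \<in> T \<and> openin cantor_topology T"
    then obtain F where "finite F" "cylinder x F \<subseteq> T" unfolding openin_cantor by blast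
    then show "\<exists>y. y \<in> C \<and> y \<in> T" using x by blast
  qed simp
qed

lemma Hausdorff_cantor: "Hausdorff_space cantor_topology"
  unfolding Hausdorff_space_def
proof (intro allI impI)
  fix x y :: "'a set" assume "x \<in> topspace cantor_topology \<and> y \<in> topspace cantor_topology \<and> x \<noteq> y"
  then obtain i where i: "(i \<in> x) \<noteq> (i \<in> y)" by blast
  then have "disjnt (cylinder x {i}) (cylinder y {i})"
    by (auto simp: disjnt_def cylinder_def)
  then show "\<exists>U V. openin cantor_topology U \<and> openin cantor_topology V \<and> x \<in> U \<and> y \<in> V \<and> disjnt U V"
    by (metis cylinder_refl finite.emptyI finite.insertI openin_cylinder)
qed

text \<open>A cylinder over a finite set is clopen, so the indicator of its complement is a
  continuous separating function.\<close>

lemma completely_regular_cantor: "completely_regular_space cantor_topology"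
  unfolding completely_regular_space_def
proof (intro allI impI)
  fix S and x :: "'a set" assume Sx: "closedin cantor_topology S \<and> x \<in> topspace cantor_topology - S"
  then have "openin cantor_topology (- S)" by (simp add: closedin_def Compl_eq_Diff_UNIV)
  then obtain F where F: "finite F" "cylinder x F \<subseteq> - S" using Sx unfolding openin_cantor by auto
  define f :: "'a set \<Rightarrow> real" where "f y = (if y \<in> cylinder x F then 0 else 1)" for y
  have "continuous_map cantor_topology (top_of_set {0..1}) f"
    unfolding continuous_map_in_subtopology
  proof
    have "openin cantor_topology {y. f y \<in> U}" for U
      unfolding openin_cantor
    proof
      fix y assume "y \<in> {y. f y \<in> U}"
      then have "cylinder y F \<subseteq> {y. f y \<in> U}"
        using cylinder_eq by (smt (verit) cylinder_refl f_def mem_Collect_eq subsetI)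
      then show "\<exists>F. finite F \<and> cylinder y F \<subseteq> {y. f y \<in> U}" using F by blast
    qed
    then show "continuous_map cantor_topology euclideanreal f"
      by (simp add: continuous_map_def)
  qed (simp add: f_def)
  moreover have "f x = 0" "f ` S \<subseteq> {1}" using F by (auto simp: f_def)
  ultimately show "\<exists>f. continuous_map cantor_topology (top_of_set {0..1::real}) f \<and> f x = 0 \<and> f ` S \<subseteq> {1}"
    by blast
qed

text \<open>Compactness of the Cantor cube, by Tychonoff's theorem for functions into
  \<open>bool\<close>. The filter form serves both sequences and nets indexed by finite
  sets.\<close>

lemma cantor_cluster_point:
  fixes x :: "'b \<Rightarrow> 'a set"
  assumes "\<F> \<noteq> bot"
  obtains y where "\<And>F. finite F \<Longrightarrow> \<exists>\<^sub>F n in \<F>. x n \<in> cylinder y F"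
proof -
  have "compact_space (product_topology (\<lambda>_::'a. euclidean :: bool topology) UNIV)"
    unfolding compact_space_product_topology
    by (simp add: compact_space_def finite_imp_compact)
  then have cpt: "compact (UNIV :: ('a \<Rightarrow> bool) set)"
    by (simp add: euclidean_product_topology compact_space_def)
  define \<G> where "\<G> = filtermap (\<lambda>n i. i \<in> x n) \<F>"
  have "\<G> \<noteq> bot" using assms by (simp add: \<G>_def filtermap_bot_iff)
  with cpt obtain f where f: "inf (nhds f) \<G> \<noteq> bot"
    unfolding compact_filter by auto
  show thesis
  proof
    fix F :: "'a set" assume F: "finite F"
    \<comment> \<open>The basic open set of functions agreeing with \<open>f\<close> on
      \<open>F\<close>; the \<open>id\<close> matches the shape of
      \<open>product_topology_basis'\<close>.\<close>
    define W where "W = {g. \<forall>i\<in>F. g (id i) \<in> {f i}}"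
    have "open W" unfolding W_def
      by (rule product_topology_basis') (use F in \<open>auto simp: open_discrete\<close>)
    then have ev: "eventually (\<lambda>g. g \<in> W) (nhds f)"
      by (rule eventually_nhds_in_open) (simp add: W_def)
    show "\<exists>\<^sub>F n in \<F>. x n \<in> cylinder (Collect f) F"
    proof (rule ccontr)
      assume "\<not> (\<exists>\<^sub>F n in \<F>. x n \<in> cylinder (Collect f) F)"
      then have "\<forall>\<^sub>F n in \<F>. x n \<notin> cylinder (Collect f) F" by (simp add: not_frequently)
      then have "\<forall>\<^sub>F n in \<F>. (\<lambda>i. i \<in> x n) \<notin> W"
        by (rule eventually_mono) (auto simp: W_def cylinder_def)
      then have "eventually (\<lambda>g. g \<notin> W) \<G>" by (simp add: \<G>_def eventually_filtermap)
      then have "eventually (\<lambda>g. False) (inf (nhds f) \<G>)"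
        unfolding eventually_inf using ev by blast
      then show False using f by (simp add: trivial_limit_def)
    qed
  qed
qed

section \<open>Boolean groups of sets\<close>

text \<open>Every set is its own inverse under symmetric difference, so this is exactly the
  condition for a subgroup.\<close>

definition xor_closed :: "'a set set \<Rightarrow> bool" where
  "xor_closed A \<longleftrightarrow> {} \<in> A \<and> (\<forall>x\<in>A. \<forall>y\<in>A. sym_diff x y \<in> A)"

definition xor_group :: "'a set set \<Rightarrow> 'a set monoid" where
  "xor_group A = \<lparr>carrier = A, mult = sym_diff, one = {}\<rparr>"

lemma xor_group_simps [simp]:
  "carrier (xor_group A) = A" "x \<otimes>\<^bsub>xor_group A\<^esub> y = sym_diff x y" "\<one>\<^bsub>xor_group A\<^esub> = {}"
  by (simp_all add: xor_group_def)

lemma comm_group_xor_group: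
  assumes "xor_closed A" shows "comm_group (xor_group A)"
proof (rule comm_groupI)
  fix x assume "x \<in> carrier (xor_group A)"
  then show "\<exists>y\<in>carrier (xor_group A). y \<otimes>\<^bsub>xor_group A\<^esub> x = \<one>\<^bsub>xor_group A\<^esub>" by auto
qed (use assms in \<open>auto simp: xor_closed_def\<close>)

lemma inv_xor_group:
  assumes "xor_closed A" "x \<in> A" shows "inv\<^bsub>xor_group A\<^esub> x = x"
proof -
  interpret comm_group "xor_group A" by (rule comm_group_xor_group [OF assms(1)])
  show ?thesis by (rule inv_equality) (use assms in auto)
qed

lemma subgroup_xor_group:
  assumes "xor_closed A"
  shows "subgroup B (xor_group A) \<longleftrightarrow> B \<subseteq> A \<and> xor_closed B"
proof
  assume "subgroup B (xor_group A)"
  then show "B \<subseteq> A \<and> xor_closed B"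
    by (auto simp: subgroup_def xor_closed_def)
next
  assume B: "B \<subseteq> A \<and> xor_closed B"
  then show "subgroup B (xor_group A)"
    unfolding subgroup_def using inv_xor_group [OF assms] by (auto simp: xor_closed_def subset_iff)
qed

text \<open>The trace of \<open>sym_diff x y\<close> on \<open>F\<close> depends only on the traces
  of \<open>x\<close> and \<open>y\<close> on \<open>F\<close>, and inversion is the
  identity.\<close>

lemma topological_group_xor_group:
  assumes A: "xor_closed A"
  shows "topological_group (xor_group A) (subtopology cantor_topology A)"
  unfolding topological_group_def
proof (intro conjI)
  let ?X = "subtopology cantor_topology A"
  show "group (xor_group A)" using comm_group_xor_group [OF A] by (simp add: comm_group_def)
  show "topspace ?X = carrier (xor_group A)" by simp
  show "Hausdorff_space ?X" by (simp add: Hausdorff_cantor Hausdorff_space_subtopology)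
  show "continuous_map ?X ?X (\<lambda>x. inv\<^bsub>xor_group A\<^esub> x)"
    using continuous_map_eq [OF continuous_map_id, of ?X "\<lambda>x. inv\<^bsub>xor_group A\<^esub> x"] inv_xor_group [OF A]
    by simp
  have "continuous_map (prod_topology ?X ?X) cantor_topology (\<lambda>(x, y). sym_diff x y)"
    unfolding continuous_map
  proof (intro conjI allI impI)
    fix U :: "'a set set" assume U: "openin cantor_topology U"
    show "openin (prod_topology ?X ?X) {p \<in> topspace (prod_topology ?X ?X). (case p of (x, y) \<Rightarrow> sym_diff x y) \<in> U}"
      (is "openin _ ?W")
      unfolding openin_prod_topology_alt
    proof (intro allI impI)
      fix x y assume "(x, y) \<in> ?W"
      then have xy: "x \<in> A" "y \<in> A" "sym_diff x y \<in> U" by auto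
      then obtain F where F: "finite F" "cylinder (sym_diff x y) F \<subseteq> U" 
        using U unfolding openin_cantor by blast
      have "sym_diff x' y' \<in> cylinder (sym_diff x y) F" 
        if "x' \<in> cylinder x F" "y' \<in> cylinder y F" for x' y'
        using that unfolding cylinder_def by blast
      then have sub: "(cylinder x F \<inter> A) \<times> (cylinder y F \<inter> A) \<subseteq> ?W"
        using F by auto
      have "openin ?X (cylinder x F \<inter> A)" "openin ?X (cylinder y F \<inter> A)"
        using openin_cylinder [OF F(1)] by (auto simp: openin_subtopology)
      then show "\<exists>U V. openin ?X U \<and> openin ?X V \<and> x \<in> U \<and> y \<in> V \<and> U \<times> V \<subseteq> ?W"
        using sub xy
        by (intro exI [of _ "cylinder x F \<inter> A"] exI [of _ "cylinder y F \<inter> A"]) simp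
    qed
  qed auto
  then show "continuous_map (prod_topology ?X ?X) ?X (\<lambda>(x, y). x \<otimes>\<^bsub>xor_group A\<^esub> y)"
    using A by (auto simp: continuous_map_in_subtopology xor_closed_def)
qed

lemma tychonoff_cantor_subtopology: "tychonoff_space (subtopology cantor_topology A)"
  by (simp add: tychonoff_space_def Hausdorff_cantor Hausdorff_space_subtopology
      completely_regular_cantor completely_regular_space_subtopology)

section \<open>Transfinite selection of independent points\<close>

text \<open>The sum of the family \<open>f\<close> over a finite \<open>P\<close> in the Boolean
  group, read off at each coordinate as a parity. Summing over indices rather than values keeps
  repeated values apart.\<close>

definition xor_sum :: "('b \<Rightarrow> 'a set) \<Rightarrow> 'b set \<Rightarrow> 'a set" where
  "xor_sum f P = {i. odd (card {p\<in>P. i \<in> f p})}"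

text \<open>For a subgroup \<open>S\<close>, this is the subgroup generated by \<open>S\<close> and
  the values of \<open>f\<close> on \<open>R\<close>.\<close>

definition xor_span :: "'a set set \<Rightarrow> ('b \<Rightarrow> 'a set) \<Rightarrow> 'b set \<Rightarrow> 'a set set" where
  "xor_span S f R = {sym_diff s (xor_sum f P) | s P. s \<in> S \<and> finite P \<and> P \<subseteq> R}"

section \<open>Algebra of finite sums and spans\<close>

lemma odd_card_sym_diff:
  assumes "finite A" "finite B"
  shows "odd (card (sym_diff A B)) \<longleftrightarrow> odd (card A) \<noteq> odd (card B)"
proof -
  have "card (sym_diff A B) = card (A - B) + card (B - A)"
    using assms by (intro card_Un_disjoint) auto
  moreover have "card A = card (A - B) + card (A \<inter> B)" "card B = card (B - A) + card (A \<inter> B)"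
    using assms by (metis add.commute card_Diff_subset_Int card_Int_Diff inf_commute)+
  ultimately show ?thesis by auto
qed

lemma xor_sum_sym_diff:
  assumes "finite P" "finite Q"
  shows "xor_sum f (sym_diff P Q) = sym_diff (xor_sum f P) (xor_sum f Q)"
proof -
  have "{p \<in> sym_diff P Q. i \<in> f p} = sym_diff {p\<in>P. i \<in> f p} {p\<in>Q. i \<in> f p}" for i
    by auto
  then show ?thesis
    unfolding xor_sum_def using assms by (auto simp: odd_card_sym_diff)
qed

lemma xor_sum_empty [simp]: "xor_sum f {} = {}"
  by (simp add: xor_sum_def)

lemma xor_sum_singleton [simp]: "xor_sum f {p} = f p"
proof -
  have "{q. q = p \<and> i \<in> f q} = (if i \<in> f p then {p} else {})" for i by auto
  then show ?thesis by (simp add: xor_sum_def)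
qed

lemma xor_sum_cong:
  assumes "\<And>p. p \<in> P \<Longrightarrow> f p = g p" shows "xor_sum f P = xor_sum g P"
proof -
  have "{p\<in>P. i \<in> f p} = {p\<in>P. i \<in> g p}" for i using assms by auto
  then show ?thesis by (simp add: xor_sum_def)
qed

lemma xor_sum_in:
  assumes "xor_closed V" "finite P" "f ` P \<subseteq> V"
  shows "xor_sum f P \<in> V"
  using assms(2,3)
proof (induction P)
  case empty
  then show ?case using assms(1) by (simp add: xor_closed_def)
next
  case (insert p P)
  have "xor_sum f (insert p P) = xor_sum f (sym_diff {p} P)" 
    using insert by (intro arg_cong [of _ _ "xor_sum f"]) auto
  also have "\<dots> = sym_diff (f p) (xor_sum f P)"
    using insert by (subst xor_sum_sym_diff) auto
  finally show ?case using insert assms(1) by (simp add: xor_closed_def)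
qed

lemma xor_spanI: "s \<in> S \<Longrightarrow> finite P \<Longrightarrow> P \<subseteq> R \<Longrightarrow> sym_diff s (xor_sum f P) \<in> xor_span S f R"
  unfolding xor_span_def by blast

lemma xor_spanE:
  assumes "x \<in> xor_span S f R"
  obtains s P where "x = sym_diff s (xor_sum f P)" "s \<in> S" "finite P" "P \<subseteq> R"
  using assms unfolding xor_span_def by blast

lemma xor_span_cong:
  assumes "\<And>p. p \<in> R \<Longrightarrow> f p = g p" shows "xor_span S f R = xor_span S g R"
proof -
  have "xor_sum f P = xor_sum g P" if "P \<subseteq> R" for P
    using assms that by (intro xor_sum_cong) auto
  then show ?thesis unfolding xor_span_def by blast
qed

lemma xor_closed_xor_span:
  assumes "xor_closed S" shows "xor_closed (xor_span S f R)"
  unfolding xor_closed_def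
proof (intro conjI ballI)
  show "{} \<in> xor_span S f R"
    using xor_spanI [of "{}" S "{}" R f] assms by (simp add: xor_closed_def)
  fix x y assume "x \<in> xor_span S f R" "y \<in> xor_span S f R"
  then obtain s P t Q where
    *: "x = sym_diff s (xor_sum f P)" "s \<in> S" "finite P" "P \<subseteq> R"
       "y = sym_diff t (xor_sum f Q)" "t \<in> S" "finite Q" "Q \<subseteq> R"
    by (metis xor_spanE)
  have "sym_diff x y = sym_diff (sym_diff s t) (xor_sum f (sym_diff P Q))"
    unfolding xor_sum_sym_diff [OF *(3,7)] *(1,5) by blast
  also have "\<dots> \<in> xor_span S f R"
    by (rule xor_spanI) (use * assms in \<open>auto simp: xor_closed_def\<close>)
  finally show "sym_diff x y \<in> xor_span S f R" .
qed

lemma xor_span_subset: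
  assumes "xor_closed V" "S \<subseteq> V" "f ` R \<subseteq> V"
  shows "xor_span S f R \<subseteq> V"
proof
  fix x assume "x \<in> xor_span S f R"
  then obtain s P where *: "x = sym_diff s (xor_sum f P)" "s \<in> S" "finite P" "P \<subseteq> R"
    by (rule xor_spanE)
  moreover have "xor_sum f P \<in> V"
    using assms * by (intro xor_sum_in) auto
  ultimately show "x \<in> V" using assms by (auto simp: xor_closed_def)
qed

lemma subset_xor_span: "S \<subseteq> xor_span S f R"
  using xor_spanI [of _ S "{}" R f] by auto

lemma image_subset_xor_span: "xor_closed S \<Longrightarrow> f ` R \<subseteq> xor_span S f R"
  using xor_spanI [of "{}" S "{_}" R f] by (auto simp: xor_closed_def)

section \<open>Cardinality of spans\<close>

text \<open>The finite subsets split into countably many layers by size, and each layer arises from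
  the previous one by inserting a single point of \<open>R\<close>.\<close>

lemma card_of_finite_subsets:
  assumes "infinite R" shows "|{P. finite P \<and> P \<subseteq> R}| \<le>o |R|"
proof -
  have *: "|{P. finite P \<and> P \<subseteq> R \<and> card P \<le> n}| \<le>o |R|" for n
  proof (induction n)
    case 0
    have "{P. finite P \<and> P \<subseteq> R \<and> card P \<le> 0} = {{}}" by auto
    then show ?case using assms by (metis card_of_singl_ordLeq finite.emptyI)
  next
    case (Suc n)
    let ?K = "{P. finite P \<and> P \<subseteq> R \<and> card P \<le> n}"
    have "P \<in> ?K \<union> (\<lambda>(p, P). insert p P) ` (R \<times> ?K)"
      if P: "finite P" "P \<subseteq> R" "card P \<le> Suc n" for P
    proof (cases "card P \<le> n")
      case False
      then obtain p where "p \<in> P" using P by (metis card.empty equals0I zero_le)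
      then have "P = (\<lambda>(p, P). insert p P) (p, P - {p})" "(p, P - {p}) \<in> R \<times> ?K"
        using P by auto
      then show ?thesis by blast
    qed (use P in auto)
    then have "{P. finite P \<and> P \<subseteq> R \<and> card P \<le> Suc n} \<subseteq> ?K \<union> (\<lambda>(p, P). insert p P) ` (R \<times> ?K)"
      by blast
    moreover have "|(\<lambda>(p, P). insert p P) ` (R \<times> ?K)| \<le>o |R|"
      by (rule ordLeq_transitive [OF card_of_image card_of_Sigma_ordLeq_infinite [OF assms]])
        (use Suc in \<open>simp_all add: card_of_mono1\<close>)
    moreover have "Cinfinite |R|"
      using assms by (simp add: cinfinite_def Field_card_of card_of_card_order_on)
    ultimately show ?case
      using Suc by (blast intro: ordLeq_transitive [OF card_of_mono1 Un_Cinfinite_bound])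
  qed
  have "{P. finite P \<and> P \<subseteq> R} = (\<Union>n\<in>(UNIV::nat set). {P. finite P \<and> P \<subseteq> R \<and> card P \<le> n})"
    by auto
  then show ?thesis
    using card_of_UNION_ordLeq_infinite [OF assms, of "UNIV::nat set" "\<lambda>n. {P. finite P \<and> P \<subseteq> R \<and> card P \<le> n}"]
      * assms infinite_iff_card_of_nat [of R] by simp
qed

lemma card_of_finite_less: "finite A \<Longrightarrow> infinite B \<Longrightarrow> |A| <o |B|"
  by (rule finite_ordLess_infinite) (use card_of_Well_order in \<open>auto simp: Field_card_of\<close>)

text \<open>If a factor is infinite, the larger one absorbs the product; otherwise the product is
  finite.\<close>

lemma card_of_Times_less:
  assumes "infinite A" "|X| <o |A|" "|Y| <o |A|"
  shows "|X \<times> Y| <o |A|"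
proof (cases "finite X \<and> finite Y")
  case True
  then show ?thesis using assms(1) by (simp add: card_of_finite_less)
next
  case False
  have "|X| \<le>o |Y| \<or> |Y| \<le>o |X|" by (rule ordLeq_total) (rule card_of_Well_order)+
  then show ?thesis
  proof
    assume le: "|X| \<le>o |Y|"
    then have "infinite Y" using False card_of_ordLeq_finite by blast
    then show ?thesis using card_of_Sigma_ordLeq_infinite [of Y X "\<lambda>_. Y"] le assms
      by (meson card_of_mono1 ordLeq_ordLess_trans subset_refl)
  next
    assume le: "|Y| \<le>o |X|"
    then have "infinite X" using False card_of_ordLeq_finite by blast
    then show ?thesis using card_of_Sigma_ordLeq_infinite [of X X "\<lambda>_. Y"] le assms
      by (meson card_of_mono1 ordLeq_ordLess_trans subset_refl)
  qed
qed

text \<open>This keeps the recursion going: fewer than \<open>|A|\<close> generators over a small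
  \<open>S\<close> cannot exhaust \<open>A\<close>. The span is an image of the product of
  \<open>S\<close> with the finite subsets of \<open>R\<close>.\<close>

lemma card_of_xor_span_less:
  assumes "infinite A" "|S| <o |A|" "|R| <o |A|"
  shows "|xor_span S f R| <o |A|"
proof -
  have "|{P. finite P \<and> P \<subseteq> R}| <o |A|"
  proof (cases "finite R")
    case True
    then have "finite {P. finite P \<and> P \<subseteq> R}" by simp
    then show ?thesis using assms(1) by (simp add: card_of_finite_less)
  next
    case False
    then show ?thesis using card_of_finite_subsets assms(3) ordLeq_ordLess_trans by blast
  qed
  then have "|S \<times> {P. finite P \<and> P \<subseteq> R}| <o |A|"
    using assms by (simp add: card_of_Times_less)
  moreover have "xor_span S f R = (\<lambda>(s, P). sym_diff s (xor_sum f P)) ` (S \<times> {P. finite P \<and> P \<subseteq> R})"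
    unfolding xor_span_def by auto
  ultimately show ?thesis using ordLeq_ordLess_trans [OF card_of_image] by simp
qed

section \<open>The transfinite choice\<close>

text \<open>Supplies the last index occurring in a supposed relation among the chosen
  points.\<close>

lemma Well_order_finite_greatest:
  assumes "Well_order r" "finite P" "P \<noteq> {}" "P \<subseteq> Field r"
  shows "\<exists>t\<in>P. \<forall>p\<in>P. (p, t) \<in> r"
proof -
  have wo: "wo_rel r" using assms(1) by (simp add: wo_rel_def)
  note total = wo_rel.TOTALS [OF wo] and trans = wo_rel.TRANS [OF wo]
  show ?thesis
    using assms(2,3,4)
  proof (induction rule: finite_ne_induct)
    case (singleton t)
    then show ?case using total by auto
  next
    case (insert q P)
    then obtain t where t: "t \<in> P" "\<And>p. p \<in> P \<Longrightarrow> (p, t) \<in> r" by auto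
    then have "(q, t) \<in> r \<or> (t, q) \<in> r" "(q, q) \<in> r"
      using total insert.prems by blast+
    then consider "(q, t) \<in> r" | "(t, q) \<in> r" "(q, q) \<in> r" by blast
    then show ?case
    proof cases
      case 1
      then show ?thesis using t by blast
    next
      case 2
      then have "\<forall>p\<in>insert q P. (p, q) \<in> r" using t transD [OF trans] by blast
      then show ?thesis by blast
    qed
  qed
qed

text \<open>Each new point is chosen in its prescribed set outside the span of \<open>S\<close> and
  all earlier points. The chosen points are then independent modulo \<open>S\<close>, so disjoint
  families of them generate subgroups over \<open>S\<close> that meet only in
  \<open>S\<close>.\<close>

lemma independent_selection:
  fixes S V :: "'a set set" and \<A> :: "'a set set set"
  assumes "xor_closed V" "xor_closed S" "S \<subseteq> V"
    and sub: "\<And>A. A \<in> \<A> \<Longrightarrow> A \<subseteq> V"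
    and inf: "\<And>A. A \<in> \<A> \<Longrightarrow> infinite A"
    and S_less: "\<And>A. A \<in> \<A> \<Longrightarrow> |S| <o |A|"
    and \<A>_le: "\<And>A. A \<in> \<A> \<Longrightarrow> |\<A>| \<le>o |A|"
  obtains G H where "xor_closed G" "xor_closed H" "G \<subseteq> V" "H \<subseteq> V" "G \<inter> H = S"
    "\<And>A. A \<in> \<A> \<Longrightarrow> G \<inter> A \<noteq> {}" "\<And>A. A \<in> \<A> \<Longrightarrow> H \<inter> A \<noteq> {}"
proof -
  \<comment> \<open>Two points are chosen in every prescribed set; the flag tells which of the two
    groups receives the point.\<close>
  define T where "T = \<A> \<times> (UNIV :: bool set)"
  \<comment> \<open>A cardinal well-order has proper initial segments smaller than \<open>T\<close>,
    so fewer than \<open>|T|\<close> points precede each stage.\<close>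
  define r where "r = |T|"
  have wo: "Well_order r" and Field_r: "Field r = T" and co: "Card_order r"
    unfolding r_def using card_of_Well_order [of T] card_of_Card_order [of T] by (auto simp: Field_card_of)
  have "\<exists>f. \<forall>t. t \<in> T \<longrightarrow> f t \<in> fst t \<and> f t \<notin> xor_span S f (underS r t)"
  proof (rule dependent_wf_choice [where R = "r - Id" and
        P = "\<lambda>f t z. t \<in> T \<longrightarrow> z \<in> fst t \<and> z \<notin> xor_span S f (underS r t)"])
    show "wf (r - Id)" using wo by (simp add: well_order_on_def)
  next
    fix f g :: "'a set set \<times> bool \<Rightarrow> 'a set" and t z
    assume "\<And>u. (u, t) \<in> r - Id \<Longrightarrow> f u = g u"
    then have "xor_span S f (underS r t) = xor_span S g (underS r t)"
      by (intro xor_span_cong) (auto simp: underS_def)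
    then show "(t \<in> T \<longrightarrow> z \<in> fst t \<and> z \<notin> xor_span S f (underS r t)) =
               (t \<in> T \<longrightarrow> z \<in> fst t \<and> z \<notin> xor_span S g (underS r t))" by simp
  next
    fix t and f :: "'a set set \<times> bool \<Rightarrow> 'a set"
    show "\<exists>z. t \<in> T \<longrightarrow> z \<in> fst t \<and> z \<notin> xor_span S f (underS r t)"
    proof (cases "t \<in> T")
      case True
      then have A: "fst t \<in> \<A>" by (auto simp: T_def)
      have "|underS r t| <o |T|"
        using card_of_underS [OF co] True Field_r by (simp add: r_def)
      \<comment> \<open>\<open>fst t\<close> is infinite and at least as large as \<A>, so doubling
        \<A> does no harm.\<close>
      moreover have "|T| \<le>o |fst t|"
        unfolding T_def
        by (rule card_of_Sigma_ordLeq_infinite)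
          (use A inf \<A>_le in \<open>auto intro!: ordLess_imp_ordLeq card_of_finite_less\<close>)
      ultimately have "|xor_span S f (underS r t)| <o |fst t|"
        using A inf S_less by (meson card_of_xor_span_less ordLess_ordLeq_trans)
      then have "\<not> fst t \<subseteq> xor_span S f (underS r t)"
        using card_of_mono1 not_ordLess_ordLeq by blast
      then show ?thesis by blast
    qed auto
  qed
  then obtain f where f: "\<And>t. t \<in> T \<Longrightarrow> f t \<in> fst t"
      and new: "\<And>t. t \<in> T \<Longrightarrow> f t \<notin> xor_span S f (underS r t)" by blast
  \<comment> \<open>A nonempty relation modulo \<open>S\<close> would express the point of greatest
    index through earlier ones.\<close>
  have indep: "P = {}" if P: "finite P" "P \<subseteq> T" "xor_sum f P \<in> S" for P
  proof (rule ccontr)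
    assume "P \<noteq> {}"
    then have "\<exists>t\<in>P. \<forall>p\<in>P. (p, t) \<in> r"
      using P Field_r by (intro Well_order_finite_greatest [OF wo]) auto
    then obtain t where t: "t \<in> P" "\<And>p. p \<in> P \<Longrightarrow> (p, t) \<in> r" by blast
    have eq: "sym_diff P (P - {t}) = {t}" using t(1) by auto
    have "f t = xor_sum f (sym_diff P (P - {t}))"
      unfolding eq by simp
    also have "\<dots> = sym_diff (xor_sum f P) (xor_sum f (P - {t}))"
      using P by (subst xor_sum_sym_diff) auto
    also have "\<dots> \<in> xor_span S f (underS r t)"
      by (rule xor_spanI) (use P t in \<open>auto simp: underS_def\<close>)
    finally show False using new t(1) P(2) by blast
  qed
  define G where "G b = xor_span S f (\<A> \<times> {b})" for b
  have "G True \<inter> G False \<subseteq> S"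
  proof
    fix x assume "x \<in> G True \<inter> G False"
    then obtain s P t Q where
      *: "x = sym_diff s (xor_sum f P)" "s \<in> S" "finite P" "P \<subseteq> \<A> \<times> {True}"
         "x = sym_diff t (xor_sum f Q)" "t \<in> S" "finite Q" "Q \<subseteq> \<A> \<times> {False}"
      unfolding G_def by (metis IntE xor_spanE)
    have "sym_diff s t = xor_sum f (sym_diff P Q)"
      unfolding xor_sum_sym_diff [OF *(3,7)] using *(1,5) by blast
    moreover have "sym_diff s t \<in> S" using * assms by (simp add: xor_closed_def)
    \<comment> \<open>\<open>P\<close> and \<open>Q\<close> carry different flags and are disjoint,
      so this forces both to be empty.\<close>
    ultimately have "sym_diff P Q = {}"
      using * by (intro indep) (auto simp: T_def)
    then have "P = {}" using * by auto
    then show "x \<in> S" using * by simp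
  qed
  then have "G True \<inter> G False = S"
    using subset_xor_span unfolding G_def by blast
  moreover have "xor_closed (G b)" "G b \<subseteq> V" for b
  proof -
    have "f ` (\<A> \<times> {b}) \<subseteq> V" using f sub by (fastforce simp: T_def)
    then show "xor_closed (G b)" "G b \<subseteq> V"
      unfolding G_def using assms(1-3) by (simp_all add: xor_closed_xor_span xor_span_subset)
  qed
  moreover have "G b \<inter> A \<noteq> {}" if "A \<in> \<A>" for b A
  proof -
    have "f (A, b) \<in> A" using f [of "(A, b)"] that by (simp add: T_def)
    moreover have "f (A, b) \<in> G b"
      using image_subset_xor_span [OF assms(2), of f "\<A> \<times> {b}"] that unfolding G_def by blast
    ultimately show ?thesis by blast
  qed
  ultimately show thesis using that by blast
qed

section \<open>Closed subgroups of the Cantor group\<close>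

lemma closedin_cantorD:
  assumes "closedin cantor_topology N" "\<And>F. finite F \<Longrightarrow> \<exists>c\<in>N. c \<in> cylinder x F"
  shows "x \<in> N"
proof -
  have "x \<in> cantor_topology closure_of N" using assms(2) by (simp add: closure_of_cantor)
  then show ?thesis using assms(1) by (simp add: closure_of_closedin)
qed

text \<open>For a subgroup \<open>N\<close>, this says that the coordinate functionals in
  \<open>J\<close>, restricted to \<open>N\<close>, are linearly independent over the two-element
  field.\<close>

definition finitely_shattered :: "'a set set \<Rightarrow> 'a set \<Rightarrow> bool" where
  "finitely_shattered N J \<longleftrightarrow> (\<forall>F y. finite F \<longrightarrow> F \<subseteq> J \<longrightarrow> (\<exists>x\<in>N. x \<in> cylinder y F))"

text \<open>The property has finite character: a finite subset of the union of a chain lies in one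
  member, so Zorn's lemma applies.\<close>

lemma ex_maximal_finitely_shattered:
  assumes "N \<noteq> {}"
  obtains J where "finitely_shattered N J" "\<And>J'. finitely_shattered N J' \<Longrightarrow> J \<subseteq> J' \<Longrightarrow> J' = J"
proof -
  have "\<exists>J\<in>Collect (finitely_shattered N). \<forall>J'\<in>Collect (finitely_shattered N). J \<subseteq> J' \<longrightarrow> J' = J"
  proof (rule subset_Zorn_nonempty)
    show "Collect (finitely_shattered N) \<noteq> {}"
      using assms by (auto simp: finitely_shattered_def cylinder_def intro!: exI [of _ "{}"])
  next
    fix \<C> assume \<C>: "\<C> \<noteq> {}" "subset.chain (Collect (finitely_shattered N)) \<C>"
    have "finitely_shattered N (\<Union>\<C>)"
      unfolding finitely_shattered_def
    proof (intro allI impI)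
      fix F y :: "'a set" assume "finite F" "F \<subseteq> \<Union>\<C>"
      then obtain J where "J \<in> \<C>" "F \<subseteq> J"
        using \<C> finite_subset_Union_chain by metis
      then show "\<exists>x\<in>N. x \<in> cylinder y F"
        using \<C>(2) \<open>finite F\<close> unfolding subset.chain_def finitely_shattered_def by blast
    qed
    then show "\<Union>\<C> \<in> Collect (finitely_shattered N)" by simp
  qed
  then show thesis using that by blast
qed

text \<open>A maximal finitely shattered set of coordinates is the analogue of a basis of the dual group:
  if membership of \<open>i\<close> were not determined by finitely many coordinates of \<open>J\<close>, then
  adding to a point of \<open>N\<close> a point that vanishes on these coordinates but contains \<open>i\<close>
  would show that \<open>insert i J\<close> is finitely shattered.\<close>

lemma maximal_finitely_shattered_determines:
  assumes N: "xor_closed N" and J: "finitely_shattered N J"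
    and max: "\<And>J'. finitely_shattered N J' \<Longrightarrow> J \<subseteq> J' \<Longrightarrow> J' = J"
  obtains F where "finite F" "F \<subseteq> J" "\<And>x z. x \<in> N \<Longrightarrow> z \<in> N \<Longrightarrow> z \<in> cylinder x F \<Longrightarrow> z \<in> cylinder x {i}"
proof (cases "i \<in> J")
  case True
  show thesis by (rule that [of "{i}"]) (use True in auto)
next
  case False
  then have "\<not> finitely_shattered N (insert i J)" using max by blast
  then obtain F y where F: "finite F" "F \<subseteq> insert i J" and none: "\<And>x. x \<in> N \<Longrightarrow> x \<notin> cylinder y F"
    unfolding finitely_shattered_def by blast
  show thesis
  proof (rule that [of "F - {i}"])
    fix x z assume xz: "x \<in> N" "z \<in> N" "z \<in> cylinder x (F - {i})"
    show "z \<in> cylinder x {i}"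
    proof (rule ccontr)
      assume ne: "z \<notin> cylinder x {i}"
      define u where "u = sym_diff x z"
      have u: "u \<in> N" "u \<inter> (F - {i}) = {}" "i \<in> u"
        using N xz ne by (auto simp: u_def xor_closed_def cylinder_def)
      obtain w where w: "w \<in> N" "w \<in> cylinder y (F - {i})"
        using J F unfolding finitely_shattered_def by (metis Diff_subset_conv finite_Diff insert_is_Un)
      have wu: "sym_diff w u \<in> N" using N w u by (simp add: xor_closed_def)
      have "w \<in> cylinder y F \<or> sym_diff w u \<in> cylinder y F"
        using w(2) u(2,3) unfolding cylinder_def by blast
      then show False using none w wu by blast
    qed
  qed (use F in auto)
qed

text \<open>Compactness passes from finite patterns to full ones: choose points of \<open>N\<close>
  that agree with \<open>y\<close> on the finite subsets of \<open>J\<close> and take a cluster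
  point as these subsets grow.\<close>

lemma closed_finitely_shattered:
  assumes "closedin cantor_topology N" "finitely_shattered N J"
  shows "\<exists>x\<in>N. x \<in> cylinder y J"
proof -
  define \<F> where "\<F> = finite_subsets_at_top J"
  have "\<forall>F. \<exists>x. finite F \<longrightarrow> F \<subseteq> J \<longrightarrow> x \<in> N \<and> x \<in> cylinder y F"
    using assms(2) unfolding finitely_shattered_def by blast
  then obtain x where x: "\<And>F. finite F \<Longrightarrow> F \<subseteq> J \<Longrightarrow> x F \<in> N \<and> x F \<in> cylinder y F" by metis
  have "\<F> \<noteq> bot" by (simp add: \<F>_def)
  then obtain z where z: "\<And>F. finite F \<Longrightarrow> \<exists>\<^sub>F E in \<F>. x E \<in> cylinder z F"
    using cantor_cluster_point [of \<F> x] by blast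
  have ev: "\<forall>\<^sub>F E in \<F>. finite E \<and> E \<subseteq> J \<and> F \<subseteq> E" if "finite F" "F \<subseteq> J" for F
    unfolding \<F>_def eventually_finite_subsets_at_top using that by blast
  have "z \<in> N"
  proof (rule closedin_cantorD [OF assms(1)])
    fix F :: "'a set" assume "finite F"
    then have "\<exists>\<^sub>F E in \<F>. x E \<in> cylinder z F \<and> finite E \<and> E \<subseteq> J \<and> {} \<subseteq> E"
      by (intro frequently_eventually_frequently z ev) auto
    then obtain E where "x E \<in> cylinder z F \<and> finite E \<and> E \<subseteq> J \<and> {} \<subseteq> E" using frequently_ex by blast
    then show "\<exists>c\<in>N. c \<in> cylinder z F" using x by blast
  qed
  moreover have "(j \<in> z) = (j \<in> y)" if "j \<in> J" for j
  proof -
    have "\<exists>\<^sub>F E in \<F>. x E \<in> cylinder z {j} \<and> finite E \<and> E \<subseteq> J \<and> {j} \<subseteq> E"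
      using that by (intro frequently_eventually_frequently z ev) auto
    then obtain E where E: "x E \<in> cylinder z {j}" "finite E" "E \<subseteq> J" "j \<in> E" using frequently_ex by blast
    then have "x E \<in> cylinder y E" using x by blast
    then show ?thesis using E(1,4) by (auto simp: cylinder_def)
  qed
  then have "z \<in> cylinder y J" by (auto simp: cylinder_def)
  ultimately show ?thesis by blast
qed

text \<open>For a maximal finitely shattered \<open>J\<close>, the projection of \<open>N\<close> to
  \<open>2^J\<close> is a homeomorphism: onto by compactness, and with continuous inverse because
  each coordinate is determined on \<open>N\<close> by finitely many coordinates in
  \<open>J\<close>.\<close>

lemma closed_xor_coordinates:
  assumes N: "xor_closed N" "closedin cantor_topology N" "infinite N"
  obtains J where "infinite J" "\<And>y. \<exists>x\<in>N. x \<in> cylinder y J"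
    "\<And>F. finite F \<Longrightarrow> \<exists>F'. finite F' \<and> F' \<subseteq> J \<and> (\<forall>x\<in>N. \<forall>z\<in>N. z \<in> cylinder x F' \<longrightarrow> z \<in> cylinder x F)"
proof -
  obtain J where J: "finitely_shattered N J" "\<And>J'. finitely_shattered N J' \<Longrightarrow> J \<subseteq> J' \<Longrightarrow> J' = J"
    using ex_maximal_finitely_shattered [of N] N(3) by (metis finite.emptyI)
  have "\<forall>i. \<exists>F. finite F \<and> F \<subseteq> J \<and> (\<forall>x\<in>N. \<forall>z\<in>N. z \<in> cylinder x F \<longrightarrow> z \<in> cylinder x {i})"
    using maximal_finitely_shattered_determines [OF N(1) J] by metis
  then obtain D where D: "\<And>i. finite (D i)" "\<And>i. D i \<subseteq> J"
      "\<And>i x z. x \<in> N \<Longrightarrow> z \<in> N \<Longrightarrow> z \<in> cylinder x (D i) \<Longrightarrow> z \<in> cylinder x {i}"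
    by metis
  have det: "z \<in> cylinder x F" if "x \<in> N" "z \<in> N" "z \<in> cylinder x (\<Union>i\<in>F. D i)" for x z F
  proof -
    have "z \<in> cylinder x {i}" if "i \<in> F" for i
      using D(3) [of x z i] \<open>x \<in> N\<close> \<open>z \<in> N\<close> \<open>z \<in> cylinder x (\<Union>i\<in>F. D i)\<close>
        cylinder_mono [of "D i" "\<Union>i\<in>F. D i" x] that by blast
    then show ?thesis by (fastforce simp: cylinder_def)
  qed
  have "infinite J"
  proof
    assume "finite J"
    \<comment> \<open>Every coordinate is determined by those in \<open>J\<close>, so a finite
      \<open>J\<close> would make \<open>N\<close> finite.\<close>
    have "inj_on (\<lambda>x. x \<inter> J) N"
    proof (rule inj_onI)
      fix x z assume xz: "x \<in> N" "z \<in> N" "x \<inter> J = z \<inter> J"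
      then have "z \<in> cylinder x (\<Union>i\<in>UNIV. D i)" using D(2) by (fastforce simp: cylinder_def)
      then have "z \<in> cylinder x UNIV" using det xz by blast
      then show "x = z" by (simp add: cylinder_def)
    qed
    moreover have "finite ((\<lambda>x. x \<inter> J) ` N)"
      by (rule finite_subset [of _ "Pow J"]) (use \<open>finite J\<close> in auto)
    ultimately show False using N(3) finite_imageD by blast
  qed
  then show thesis
  proof (rule that)
    show "\<exists>x\<in>N. x \<in> cylinder y J" for y using closed_finitely_shattered [OF N(2) J(1)] .
    fix F :: "'a set" assume "finite F"
    then show "\<exists>F'. finite F' \<and> F' \<subseteq> J \<and> (\<forall>x\<in>N. \<forall>z\<in>N. z \<in> cylinder x F' \<longrightarrow> z \<in> cylinder x F)"
      using D(1,2) det by (intro exI [of _ "\<Union>i\<in>F. D i"]) blast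
  qed
qed

text \<open>Finite unions of basic open sets suffice, as each point of \<open>F \<inter> y\<close>
  has a basic neighbourhood missing the finite set \<open>F - y\<close>. This is separability of the
  cube, in the manner of Hewitt, Marczewski and Pondiczery.\<close>

lemma countable_shattering_family:
  "\<exists>\<U> :: 'a::{second_countable_topology, t1_space} set set.
     countable \<U> \<and> (\<forall>F y. finite F \<longrightarrow> (\<exists>U\<in>\<U>. U \<in> cylinder y F))"
proof -
  obtain \<B> :: "'a set set" where \<B>: "countable \<B>" "topological_basis \<B>"
    using ex_countable_basis by blast
  show ?thesis
  proof (intro exI [of _ "Union ` {\<S>. finite \<S> \<and> \<S> \<subseteq> \<B>}"] conjI allI impI)
    show "countable (Union ` {\<S>. finite \<S> \<and> \<S> \<subseteq> \<B>})"
      using countable_Collect_finite_subset [OF \<B>(1)] by simp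
    fix F y :: "'a set" assume F: "finite F"
    have "\<exists>B\<in>\<B>. e \<in> B \<and> B \<subseteq> - (F - y)" if "e \<in> F \<inter> y" for e
      using topological_basisE [OF \<B>(2), of "- (F - y)" e] that F
      by (metis ComplI DiffE IntE finite_Diff finite_imp_closed open_Compl)
    then obtain B where B: "\<And>e. e \<in> F \<inter> y \<Longrightarrow> B e \<in> \<B> \<and> e \<in> B e \<and> B e \<subseteq> - (F - y)" by metis
    have "\<Union>(B ` (F \<inter> y)) \<in> cylinder y F" using B by (fastforce simp: cylinder_def)
    moreover have "finite (B ` (F \<inter> y))" "B ` (F \<inter> y) \<subseteq> \<B>" using F B by auto
    ultimately show "\<exists>U\<in>Union ` {\<S>. finite \<S> \<and> \<S> \<subseteq> \<B>}. U \<in> cylinder y F" by blast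
  qed
qed

text \<open>A countable infinite sequence of coordinates is fixed inside \<open>J\<close>.
  Prescribing a pattern from a countable dense family on \<open>J\<close> except for a tail of this
  sequence leaves continuum many points, while any finite condition avoids some tail.\<close>

lemma countable_pi_network:
  fixes N :: "'a::{second_countable_topology, t1_space} set set"
  assumes N: "xor_closed N" "closedin cantor_topology N" "infinite N"
  shows "\<exists>\<B>. countable \<B> \<and> (\<forall>B\<in>\<B>. B \<subseteq> N \<and> |UNIV :: nat set set| \<le>o |B| ) \<and>
    (\<forall>x\<in>N. \<forall>F. finite F \<longrightarrow> (\<exists>B\<in>\<B>. B \<subseteq> cylinder x F))"
proof -
  obtain J where J: "infinite J" "\<And>y. \<exists>x\<in>N. x \<in> cylinder y J"
    "\<And>F. finite F \<Longrightarrow> \<exists>F'. finite F' \<and> F' \<subseteq> J \<and> (\<forall>x\<in>N. \<forall>z\<in>N. z \<in> cylinder x F' \<longrightarrow> z \<in> cylinder x F)"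
    using closed_xor_coordinates [OF N] by metis
  obtain \<U> :: "'a set set" where \<U>: "countable \<U>" "\<And>F y. finite F \<Longrightarrow> \<exists>U\<in>\<U>. U \<in> cylinder y F"
    using countable_shattering_family by blast
  obtain j :: "nat \<Rightarrow> 'a" where j: "inj j" "range j \<subseteq> J"
    using J(1) infinite_countable_subset by blast
  define B where "B U n = N \<inter> cylinder U (J - j ` {n..})" for U n
  show ?thesis
  proof (intro exI [of _ "(\<lambda>(U, n). B U n) ` (\<U> \<times> UNIV)"] conjI ballI allI impI)
    show "countable ((\<lambda>(U, n). B U n) ` (\<U> \<times> UNIV))" using \<U>(1) by simp
    show "A \<subseteq> N" if "A \<in> (\<lambda>(U, n). B U n) ` (\<U> \<times> UNIV)" for A
      using that by (auto simp: B_def)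
    show "|UNIV :: nat set set| \<le>o |A|" if A: "A \<in> (\<lambda>(U, n). B U n) ` (\<U> \<times> UNIV)" for A
    proof -
      obtain U n where A: "A = B U n" using A by auto
      \<comment> \<open>An arbitrary set \<open>P\<close> of naturals is coded into the free tail;
        the shift by \<open>n\<close> is there because the free coordinates start at
        \<open>j n\<close>.\<close>
      have "\<forall>P. \<exists>x\<in>N. x \<in> cylinder (U - j ` {n..} \<union> j ` ((+) n ` P)) J" using J(2) by blast
      then obtain x where x: "\<And>P. x P \<in> N" "\<And>P. x P \<in> cylinder (U - j ` {n..} \<union> j ` ((+) n ` P)) J" by metis
      have xB: "x P \<in> B U n" for P
        using x(1) [of P] x(2) [of P] by (auto simp: B_def cylinder_def)
      have mem: "k \<in> P \<longleftrightarrow> j (n + k) \<in> x P" for k P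
      proof -
        have "j (n + k) \<in> J" "j (n + k) \<in> j ` {n..}" using j by auto
        moreover have "j (n + k) \<in> j ` ((+) n ` P) \<longleftrightarrow> k \<in> P" by (auto simp: inj_image_mem_iff [OF j(1)])
        ultimately show ?thesis using x(2) [of P] unfolding cylinder_def by blast
      qed
      have "inj x" by (rule injI) (use mem in blast)
      then show ?thesis
        unfolding A using xB by (intro card_of_ordLeq [THEN iffD1] exI [of _ x]) auto
    qed
    fix x F :: "'a set" assume xF: "x \<in> N" "finite F"
    obtain F' where F': "finite F'" "F' \<subseteq> J" "\<And>z. z \<in> N \<Longrightarrow> z \<in> cylinder x F' \<Longrightarrow> z \<in> cylinder x F"
      using J(3) [OF xF(2)] xF(1) by blast
    obtain U where U: "U \<in> \<U>" "U \<in> cylinder x F'" using \<U>(2) [OF F'(1)] by blast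
    \<comment> \<open>Only finitely many indices of the sequence meet \<open>F'\<close>, so some
      tail misses it.\<close>
    have "finite (j -` F')" using F'(1) j(1) by (intro finite_vimageI) auto
    then obtain n where "\<And>k. k \<in> j -` F' \<Longrightarrow> k < n"
      by (meson finite_nat_set_iff_bounded)
    then have "F' \<subseteq> J - j ` {n..}" using F'(2) by fastforce
    then have "B U n \<subseteq> N \<inter> cylinder U F'" using cylinder_mono by (fastforce simp: B_def)
    also have "\<dots> \<subseteq> cylinder x F" using F'(3) cylinder_eq [OF U(2)] by auto
    finally show "\<exists>A\<in>(\<lambda>(U, n). B U n) ` (\<U> \<times> UNIV). A \<subseteq> cylinder x F" using U(1) by auto
  qed
qed

lemma separable_cantor_subtopologyI:
  assumes "countable D" "D \<subseteq> C" "\<And>x F. x \<in> C \<Longrightarrow> finite F \<Longrightarrow> \<exists>d\<in>D. d \<in> cylinder x F"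
  shows "separable_space (subtopology cantor_topology C)"
proof -
  have "C \<subseteq> cantor_topology closure_of D" using assms(3) by (auto simp: closure_of_cantor)
  then show ?thesis
    unfolding separable_space_def using assms(1,2)
    by (intro exI [of _ D]) (auto simp: closure_of_subtopology Int_absorb1)
qed

section \<open>Pseudocompactness and the finite subsets\<close>

text \<open>If \<open>f\<close> were unbounded along \<open>x n\<close>, finite sets
  \<open>F n\<close> would control \<open>f\<close> near these points. A cluster point of the
  sequence is imitated within \<open>G\<close> on the countable union of the \<open>F n\<close>, and
  continuity at the imitation contradicts the growth.\<close>

lemma pseudocompact_cantor_subtopology:
  assumes G: "G \<subseteq> Pow I" and meets: "\<And>J y. countable J \<Longrightarrow> y \<subseteq> I \<Longrightarrow> \<exists>x\<in>G. x \<in> cylinder y J"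
  shows "pseudocompact_space (subtopology cantor_topology G)"
  unfolding pseudocompact_space_def
proof (intro conjI allI impI tychonoff_cantor_subtopology)
  let ?X = "subtopology cantor_topology G"
  fix f :: "'a set \<Rightarrow> real" assume f: "continuous_map ?X euclideanreal f"
  have nbhd: "\<exists>F. finite F \<and> (\<forall>z\<in>G. z \<in> cylinder x F \<longrightarrow> \<bar>f z - f x\<bar> < 1)" if "x \<in> G" for x
  proof -
    have "openin ?X {z \<in> topspace ?X. f z \<in> ball (f x) 1}"
      using f by (rule openin_continuous_map_preimage) simp
    then obtain U where U: "openin cantor_topology U" "{z \<in> topspace ?X. f z \<in> ball (f x) 1} = U \<inter> G"
      unfolding openin_subtopology by blast
    have "x \<in> {z \<in> topspace ?X. f z \<in> ball (f x) 1}" using that by simp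
    then have "x \<in> U" using U(2) by blast
    then obtain F where F: "finite F" "cylinder x F \<subseteq> U" using U(1) unfolding openin_cantor by blast
    have "\<bar>f z - f x\<bar> < 1" if "z \<in> G" "z \<in> cylinder x F" for z
    proof -
      have "z \<in> {z \<in> topspace ?X. f z \<in> ball (f x) 1}" unfolding U(2) using F that by blast
      then show ?thesis by (simp add: dist_real_def abs_minus_commute)
    qed
    then show ?thesis using F(1) by blast
  qed
  show "bounded (f ` topspace ?X)"
  proof (rule ccontr)
    assume "\<not> bounded (f ` topspace ?X)"
    then have "\<forall>n::nat. \<exists>x\<in>G. real n < \<bar>f x\<bar>"
      unfolding bounded_iff by (force simp: not_le)
    then obtain x where x: "\<And>n. x n \<in> G" "\<And>n::nat. real n < \<bar>f (x n)\<bar>" by metis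
    obtain F where F: "\<And>n. finite (F n)" "\<And>n z. z \<in> G \<Longrightarrow> z \<in> cylinder (x n) (F n) \<Longrightarrow> \<bar>f z - f (x n)\<bar> < 1"
      using nbhd [OF x(1)] by metis
    obtain y where y: "\<And>E. finite E \<Longrightarrow> \<exists>\<^sub>F n in sequentially. x n \<in> cylinder y E"
      using cantor_cluster_point [of sequentially x] by auto
    define J where "J = (\<Union>n. F n)"
    have "countable J" unfolding J_def using F(1) by (simp add: countable_finite)
    have "y \<subseteq> I"
    proof
      fix i assume "i \<in> y"
      obtain n where "x n \<in> cylinder y {i}" using frequently_ex [OF y [of "{i}"]] by auto
      then show "i \<in> I" using \<open>i \<in> y\<close> x(1) [of n] G by (auto simp: cylinder_def)
    qed
    \<comment> \<open>The cluster point \<open>y\<close> may lie outside \<open>G\<close>;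
      \<open>w\<close> replaces it on all the relevant coordinates.\<close>
    then obtain w where w: "w \<in> G" "w \<in> cylinder y J" using meets \<open>countable J\<close> by blast
    obtain E where E: "finite E" "\<And>z. z \<in> G \<Longrightarrow> z \<in> cylinder w E \<Longrightarrow> \<bar>f z - f w\<bar> < 1"
      using nbhd [OF w(1)] by blast
    \<comment> \<open>The 2 absorbs the unit error at \<open>w\<close> and the one at
      \<open>x n\<close>.\<close>
    obtain m :: nat where m: "\<bar>f w\<bar> + 2 < real m" using reals_Archimedean2 by blast
    have "\<exists>n\<ge>m. x n \<in> cylinder y E"
      using y [OF E(1)] by (simp add: frequently_sequentially)
    then obtain n where n: "n \<ge> m" "x n \<in> cylinder y E" by blast
    \<comment> \<open>This pattern follows \<open>x n\<close> on \<open>F n\<close> and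
      \<open>w\<close> elsewhere. It agrees with \<open>w\<close> on \<open>E\<close>, since on
      \<open>E \<inter> F n\<close> both \<open>x n\<close> and \<open>w\<close> agree with
      \<open>y\<close>.\<close>
    define v where "v = (x n \<inter> F n) \<union> (w - F n)"
    have "v \<subseteq> I" using x(1) [of n] w(1) G by (auto simp: v_def)
    then obtain z where z: "z \<in> G" "z \<in> cylinder v (E \<union> F n)"
      using meets [of "E \<union> F n" v] E(1) F(1) by (auto simp: countable_finite)
    have "z \<in> cylinder (x n) (F n)"
      using z(2) by (auto simp: v_def cylinder_def)
    moreover have "v \<inter> E = w \<inter> E"
      using n(2) w(2) unfolding v_def cylinder_def J_def by blast
    then have "z \<in> cylinder w E"
      using z(2) by (auto simp: cylinder_def)
    ultimately have "\<bar>f z - f (x n)\<bar> < 1" "\<bar>f z - f w\<bar> < 1" using E F z by auto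
    then show False using x(2) [of n] m n(1) by linarith
  qed
qed

section \<open>The group of finite subsets\<close>

text \<open>A member of an open cover that contains the empty set contains every set missing some
  finite \<open>F\<close>. The remaining sets contain a point of \<open>F \<inter> I\<close>, so
  they lie in finitely many continuous images of the previous layer.\<close>

lemma compactin_cantor_card_le:
  "compactin cantor_topology {x. x \<subseteq> I \<and> finite x \<and> card x \<le> n}"
proof (induction n)
  case 0
  have "{x. x \<subseteq> I \<and> finite x \<and> card x \<le> 0} = {{}}" by auto
  then show ?case by (simp add: finite_imp_compactin)
next
  case (Suc n)
  let ?K = "\<lambda>n. {x. x \<subseteq> I \<and> finite x \<and> card x \<le> n}"
  show ?case
    unfolding compactin_def
  proof (intro conjI allI impI)
    fix \<U> assume \<U>: "Ball \<U> (openin cantor_topology) \<and> ?K (Suc n) \<subseteq> \<Union>\<U>"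
    have "{} \<in> \<Union>\<U>" using \<U> by auto
    then obtain U0 F where U0: "U0 \<in> \<U>" "finite F" "cylinder {} F \<subseteq> U0"
      using \<U> by (metis UnionE openin_cantor)
    have "compactin cantor_topology (insert i ` ?K n)" for i
    proof (rule image_compactin [OF Suc])
      have "openin cantor_topology {x. insert i x \<in> U}" if U: "openin cantor_topology U" for U
        unfolding openin_cantor
      proof
        fix x assume "x \<in> {x. insert i x \<in> U}"
        then obtain F where F: "finite F" "cylinder (insert i x) F \<subseteq> U" using U openin_cantor by blast
        have "z \<in> cylinder x F \<Longrightarrow> insert i z \<in> cylinder (insert i x) F" for z
          by (auto simp: cylinder_def)
        then show "\<exists>F. finite F \<and> cylinder x F \<subseteq> {x. insert i x \<in> U}" using F by blast
      qed
      then show "continuous_map cantor_topology cantor_topology (insert i)"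
        by (simp add: continuous_map_def)
    qed
    define W where "W = (\<Union>i\<in>F \<inter> I. insert i ` ?K n)"
    have W: "compactin cantor_topology W"
      unfolding W_def using U0(2) \<open>\<And>i. compactin cantor_topology (insert i ` ?K n)\<close> by (intro compactin_Union) auto
    have "W \<subseteq> ?K (Suc n)" by (auto simp: W_def card_insert_if)
    then have "W \<subseteq> \<Union>\<U>" using \<U> by (meson order_trans)
    then have "\<exists>\<V>. finite \<V> \<and> \<V> \<subseteq> \<U> \<and> W \<subseteq> \<Union>\<V>"
      using \<U> by (intro compactinD [OF W]) simp_all
    then obtain \<V> where \<V>: "finite \<V>" "\<V> \<subseteq> \<U>" "W \<subseteq> \<Union>\<V>" by blast
    have "?K (Suc n) \<subseteq> \<Union>(insert U0 \<V>)"
    proof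
      fix x assume x: "x \<in> ?K (Suc n)"
      show "x \<in> \<Union>(insert U0 \<V>)"
      proof (cases "x \<inter> F = {}")
        case True
        then show ?thesis using U0(3) by (auto simp: cylinder_def)
      next
        case False
        then obtain i where i: "i \<in> x" "i \<in> F" by blast
        then have "x = insert i (x - {i})" "x - {i} \<in> ?K n" "i \<in> F \<inter> I" using x by auto
        then have "x \<in> W" unfolding W_def by blast
        then show ?thesis using \<V>(3) by blast
      qed
    qed
    then show "\<exists>\<V>. finite \<V> \<and> \<V> \<subseteq> \<U> \<and> ?K (Suc n) \<subseteq> \<Union>\<V>"
      using \<V> U0(1) by (intro exI [of _ "insert U0 \<V>"]) auto
  qed simp
qed

text \<open>Countably many finite sets have a countable union. For \<open>i\<close> in
  \<open>I\<close> outside it, none of them lies in the neighbourhood of \<open>{i}\<close>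
  consisting of the sets that contain \<open>i\<close>.\<close>

lemma not_separable_finite_subsets:
  assumes "uncountable I"
  shows "\<not> separable_space (subtopology cantor_topology {x. finite x \<and> x \<subseteq> I})"
proof
  assume "separable_space (subtopology cantor_topology {x. finite x \<and> x \<subseteq> I})"
  then obtain C where "countable C" and sub: "C \<subseteq> {x. finite x \<and> x \<subseteq> I}"
      and "subtopology cantor_topology {x. finite x \<and> x \<subseteq> I} closure_of C = {x. finite x \<and> x \<subseteq> I}"
    unfolding separable_space_def topspace_subtopology topspace_cantor by auto
  then have C: "countable C" "{x. finite x \<and> x \<subseteq> I} \<subseteq> cantor_topology closure_of C"
    using closure_of_subtopology_subset by metis+
  have "countable (\<Union>x\<in>C. x)"
    using C(1) by (rule countable_UN) (use sub in \<open>auto intro: countable_finite\<close>)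
  then have "\<not> I \<subseteq> (\<Union>x\<in>C. x)" using assms countable_subset by blast
  then obtain i where i: "i \<in> I" "i \<notin> \<Union>C" by auto
  then have "{i} \<in> cantor_topology closure_of C" using C(2) by auto
  then have "\<forall>F. finite F \<longrightarrow> (\<exists>c\<in>C. c \<in> cylinder {i} F)" by (simp add: closure_of_cantor)
  then obtain c where "c \<in> C" "c \<in> cylinder {i} {i}" by (meson finite.intros)
  then show False using i by (auto simp: cylinder_def)
qed

section \<open>The groups\<close>

lemma xor_closed_closure:
  assumes "xor_closed C" shows "xor_closed (cantor_topology closure_of C)"
  unfolding xor_closed_def
proof (intro conjI ballI)
  show "{} \<in> cantor_topology closure_of C"
    using assms closure_of_subset [of C cantor_topology] by (auto simp: xor_closed_def)
  fix x y assume xy: "x \<in> cantor_topology closure_of C" "y \<in> cantor_topology closure_of C"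
  have "\<exists>c\<in>C. c \<in> cylinder (sym_diff x y) F" if F: "finite F" for F
  proof -
    obtain a b where ab: "a \<in> C" "a \<in> cylinder x F" "b \<in> C" "b \<in> cylinder y F"
      using xy F unfolding closure_of_cantor by blast
    have "sym_diff a b \<in> cylinder (sym_diff x y) F" using ab(2,4) unfolding cylinder_def by blast
    moreover have "sym_diff a b \<in> C" using assms ab by (simp add: xor_closed_def)
    ultimately show ?thesis by blast
  qed
  then show "sym_diff x y \<in> cantor_topology closure_of C" by (simp add: closure_of_cantor)
qed

lemma closure_subset_Pow:
  assumes "C \<subseteq> Pow I" shows "cantor_topology closure_of C \<subseteq> Pow I"
proof (intro subsetI PowI)
  fix x i assume "x \<in> cantor_topology closure_of C" and i: "i \<in> x"
  then have "\<forall>F. finite F \<longrightarrow> (\<exists>c\<in>C. c \<in> cylinder x F)" by (simp add: closure_of_cantor)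
  then obtain c where "c \<in> C" "c \<in> cylinder x {i}" by (meson finite.intros)
  then show "i \<in> I" using i assms by (auto simp: cylinder_def)
qed

definition closed_infinite_subgroups :: "'a set \<Rightarrow> 'a set set set" where
  "closed_infinite_subgroups I =
     {N. xor_closed N \<and> closedin cantor_topology N \<and> infinite N \<and> N \<subseteq> Pow I}"

text \<open>Let \<open>N\<close> be the closure of \<open>C\<close> in the whole cube. As
  \<open>C\<close> is closed in \<open>G\<close>, points of \<open>G\<close> lying in
  \<open>N\<close> already lie in \<open>C\<close>; one such point from each member of the
  \<pi>-network gives a dense set.\<close>

lemma closed_subgroup_separable:
  assumes G: "G \<subseteq> Pow I"
    and meets: "\<And>N. N \<in> closed_infinite_subgroups I \<Longrightarrow>
      \<exists>\<B>. countable \<B> \<and> (\<forall>B\<in>\<B>. B \<subseteq> N \<and> G \<inter> B \<noteq> {}) \<and>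
          (\<forall>x\<in>N. \<forall>F. finite F \<longrightarrow> (\<exists>B\<in>\<B>. B \<subseteq> cylinder x F))"
    and C: "C \<subseteq> G" "xor_closed C" "closedin (subtopology cantor_topology G) C"
  shows "separable_space (subtopology cantor_topology C)"
proof (cases "finite C")
  case True
  then show ?thesis
    by (intro separable_cantor_subtopologyI [of C]) (blast intro: countable_finite cylinder_refl)+
next
  case False
  define N where "N = cantor_topology closure_of C"
  have CN: "C \<subseteq> N" unfolding N_def by (simp add: closure_of_subset)
  have "N \<in> closed_infinite_subgroups I"
    unfolding closed_infinite_subgroups_def
    using xor_closed_closure [OF C(2)] closure_subset_Pow [of C I] C(1) G False
      infinite_super [OF CN] by (auto simp: N_def)
  then obtain \<B> where \<B>: "countable \<B>" "\<And>B. B \<in> \<B> \<Longrightarrow> B \<subseteq> N \<and> G \<inter> B \<noteq> {}"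
      "\<And>x F. x \<in> N \<Longrightarrow> finite F \<Longrightarrow> \<exists>B\<in>\<B>. B \<subseteq> cylinder x F"
    using meets by metis
  obtain T where T: "closedin cantor_topology T" "C = T \<inter> G"
    using C(3) unfolding closedin_subtopology by blast
  have "N \<subseteq> T" unfolding N_def using T by (simp add: closure_of_minimal)
  then have NG: "N \<inter> G \<subseteq> C" using T(2) by blast
  have "\<forall>B\<in>\<B>. \<exists>d. d \<in> G \<inter> B" using \<B>(2) by blast
  then obtain d where d: "\<And>B. B \<in> \<B> \<Longrightarrow> d B \<in> G \<inter> B" by metis
  show ?thesis
  proof (rule separable_cantor_subtopologyI)
    show "countable (d ` \<B>)" using \<B>(1) by simp
    show "d ` \<B> \<subseteq> C" using d \<B>(2) NG by blast
    fix x F assume "x \<in> C" "finite (F :: 'a set)"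
    then obtain B where "B \<in> \<B>" "B \<subseteq> cylinder x F" using \<B>(3) CN by blast
    then show "\<exists>e\<in>d ` \<B>. e \<in> cylinder x F" using d by blast
  qed
qed

text \<open>A closed set is determined by its traces on finite sets, that is, by a set of pairs of
  finite subsets of \<open>I\<close>; there are only \<open>|I|\<close> such pairs.\<close>

lemma card_of_closed_infinite_subgroups:
  assumes "infinite I" shows "|closed_infinite_subgroups I| \<le>o |Pow I|"
proof -
  let ?Fin = "{P. finite P \<and> P \<subseteq> I}"
  have "|?Fin| \<le>o |I|" using card_of_finite_subsets [OF assms] .
  then have "|?Fin \<times> ?Fin| \<le>o |I|"
    by (intro card_of_Sigma_ordLeq_infinite [OF assms]) auto
  \<comment> \<open>\<open>h\<close> codes pairs of finite sets as elements of \<open>I\<close>,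
    turning the family of traces into a subset of \<open>I\<close>.\<close>
  then obtain h where h: "inj_on h (?Fin \<times> ?Fin)" "h ` (?Fin \<times> ?Fin) \<subseteq> I"
    using card_of_ordLeq [of "?Fin \<times> ?Fin" I] by blast
  define tr where "tr N = (\<lambda>(x, F). (F, x \<inter> F)) ` (N \<times> ?Fin)" for N :: "'a set set"
  have tr_sub: "tr N \<subseteq> ?Fin \<times> ?Fin" for N by (auto simp: tr_def)
  have sub: "N \<subseteq> N'" if N: "N \<in> closed_infinite_subgroups I" "N' \<in> closed_infinite_subgroups I"
    and eq: "h ` tr N = h ` tr N'" for N N'
  proof
    fix x assume x: "x \<in> N"
    have "tr N = tr N'" using eq inj_on_image_eq_iff [OF h(1) tr_sub tr_sub] by blast
    show "x \<in> N'"
    proof (rule closedin_cantorD)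
      show "closedin cantor_topology N'" using N by (simp add: closed_infinite_subgroups_def)
      fix F :: "'a set" assume "finite F"
      then have "(F \<inter> I, x \<inter> (F \<inter> I)) \<in> tr N"
        unfolding tr_def using x by (intro image_eqI [of _ _ "(x, F \<inter> I)"]) auto
      then have "(F \<inter> I, x \<inter> (F \<inter> I)) \<in> tr N'" using \<open>tr N = tr N'\<close> by simp
      then obtain z where "z \<in> N'" "z \<inter> (F \<inter> I) = x \<inter> (F \<inter> I)" unfolding tr_def by auto
      moreover have "x \<subseteq> I" "z \<subseteq> I"
        using N x \<open>z \<in> N'\<close> by (auto simp: closed_infinite_subgroups_def)
      ultimately show "\<exists>z\<in>N'. z \<in> cylinder x F" unfolding cylinder_def by blast
    qed
  qed
  have "inj_on (\<lambda>N. h ` tr N) (closed_infinite_subgroups I)"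
    by (rule inj_onI) (simp add: sub subset_antisym)
  moreover have "(\<lambda>N. h ` tr N) ` closed_infinite_subgroups I \<subseteq> Pow I"
    using tr_sub h(2) by blast
  ultimately show ?thesis using card_of_ordLeq by blast
qed

lemma countable_iff_card_of_nat: "countable A \<longleftrightarrow> |A| \<le>o |UNIV :: nat set|"
  unfolding countable_def card_of_ordLeq [symmetric] by simp

lemma countable_iff_natLeq: "countable A \<longleftrightarrow> |A| \<le>o natLeq"
  unfolding countable_iff_card_of_nat
  using card_of_nat ordLeq_ordIso_trans ordIso_symmetric by blast

text \<open>The coordinates in \<open>I - J\<close> are unconstrained and include a copy of the
  naturals, on which every set of naturals can be coded.\<close>

lemma card_of_cocountable_cylinder:
  assumes "uncountable I" "countable J" "y \<subseteq> I"
  shows "|UNIV :: nat set set| \<le>o |Pow I \<inter> cylinder y J|"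
proof -
  have "infinite (I - J)" using assms by (meson uncountable_minus_countable countable_finite)
  then obtain j :: "nat \<Rightarrow> 'a" where j: "inj j" "range j \<subseteq> I - J"
    using infinite_countable_subset by blast
  have "inj (\<lambda>P. (y \<inter> J) \<union> j ` P)"
  proof (rule injI)
    fix P Q assume "(y \<inter> J) \<union> j ` P = (y \<inter> J) \<union> j ` Q"
    then have "j ` P = j ` Q" using j(2) by blast
    then show "P = Q" using j(1) by (simp add: inj_image_eq_iff)
  qed
  moreover have "range (\<lambda>P. (y \<inter> J) \<union> j ` P) \<subseteq> Pow I \<inter> cylinder y J"
    using j(2) assms(3) by (auto simp: cylinder_def)
  ultimately show ?thesis using card_of_ordLeq by blast
qed

lemma xor_closed_finite_subsets: "xor_closed {x. finite x \<and> x \<subseteq> I}"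
  by (auto simp: xor_closed_def)

section \<open>Choice of the two groups\<close>

lemma pseudocompact_pair:
  fixes I :: "'a::{second_countable_topology, t1_space} set"
  assumes I: "uncountable I" and cont: "|Pow I| \<le>o |UNIV :: nat set set|"
  obtains G H where "xor_closed G" "xor_closed H" "G \<inter> H = {x. finite x \<and> x \<subseteq> I}"
    "pseudocompact_space (subtopology cantor_topology G)"
    "pseudocompact_space (subtopology cantor_topology H)"
    "\<forall>C. C \<subseteq> G \<and> xor_closed C \<and> closedin (subtopology cantor_topology G) C \<longrightarrow>
      separable_space (subtopology cantor_topology C)"
    "\<forall>C. C \<subseteq> H \<and> xor_closed C \<and> closedin (subtopology cantor_topology H) C \<longrightarrow>
      separable_space (subtopology cantor_topology C)"
proof -
  have inf: "infinite I" "infinite (Pow I)" using I by (auto intro: countable_finite)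
  let ?\<N> = "closed_infinite_subgroups I" and ?S = "{x. finite x \<and> x \<subseteq> I}"
  have "\<exists>\<B>. N \<in> ?\<N> \<longrightarrow> countable \<B> \<and> (\<forall>B\<in>\<B>. B \<subseteq> N \<and> |UNIV :: nat set set| \<le>o |B| ) \<and>
      (\<forall>x\<in>N. \<forall>F. finite F \<longrightarrow> (\<exists>B\<in>\<B>. B \<subseteq> cylinder x F))" for N
    using countable_pi_network [of N] unfolding closed_infinite_subgroups_def by auto
  then obtain \<B> where \<B>: "\<And>N. N \<in> ?\<N> \<Longrightarrow> countable (\<B> N)"
      "\<And>N B. N \<in> ?\<N> \<Longrightarrow> B \<in> \<B> N \<Longrightarrow> B \<subseteq> N \<and> |UNIV :: nat set set| \<le>o |B|"
      "\<And>N x F. N \<in> ?\<N> \<Longrightarrow> x \<in> N \<Longrightarrow> finite F \<Longrightarrow> \<exists>B\<in>\<B> N. B \<subseteq> cylinder x F"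
    by metis
  \<comment> \<open>These are the countable faces needed for pseudocompactness. Taking
    \<open>J\<close> inside \<open>I\<close> keeps their number at most
    \<open>|Pow I|\<close>.\<close>
  define \<C> where "\<C> = (\<lambda>(y, J). Pow I \<inter> cylinder y J) ` {(y, J). y \<subseteq> I \<and> J \<subseteq> I \<and> countable J}"
  define \<A> where "\<A> = (\<Union>N\<in>?\<N>. \<B> N) \<union> \<C>"
  have "|\<C>| \<le>o |Pow I|"
  proof -
    have "|{(y, J). y \<subseteq> I \<and> J \<subseteq> I \<and> countable J}| \<le>o |Pow I \<times> Pow I|"
      by (rule card_of_mono1) auto
    also have "|Pow I \<times> Pow I| \<le>o |Pow I|"
      by (rule card_of_Sigma_ordLeq_infinite [OF inf(2)]) (simp_all add: card_of_mono1)
    finally show ?thesis unfolding \<C>_def by (rule ordLeq_transitive [OF card_of_image])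
  qed
  moreover have "|\<Union>N\<in>?\<N>. \<B> N| \<le>o |Pow I|"
  proof (rule card_of_UNION_ordLeq_infinite [OF inf(2) card_of_closed_infinite_subgroups [OF inf(1)]], rule ballI)
    fix N assume "N \<in> ?\<N>"
    then have "|\<B> N| \<le>o |UNIV :: nat set|"
      using \<B>(1) countable_iff_card_of_nat by blast
    then show "|\<B> N| \<le>o |Pow I|"
      using inf(2) infinite_iff_card_of_nat ordLeq_transitive by blast
  qed
  moreover have "Cinfinite |Pow I|"
    using inf(2) by (simp add: cinfinite_def Field_card_of card_of_card_order_on)
  ultimately have \<A>_le: "|\<A>| \<le>o |Pow I|"
    unfolding \<A>_def by (intro Un_Cinfinite_bound)
  have big: "|UNIV :: nat set set| \<le>o |A|" if "A \<in> \<A>" for A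
    using that \<B>(2) card_of_cocountable_cylinder [OF I] unfolding \<A>_def \<C>_def by auto
  have subA: "A \<subseteq> Pow I" if "A \<in> \<A>" for A
    using that \<B>(2) unfolding \<A>_def \<C>_def closed_infinite_subgroups_def by blast
  \<comment> \<open>The cardinal hypothesis enters here: no prescribed set is smaller than
    \<open>Pow I\<close>, which bounds the number of prescribed sets.\<close>
  have PowA: "|Pow I| \<le>o |A|" if "A \<in> \<A>" for A
    using ordLeq_transitive [OF cont big [OF that]] .
  have S_less: "|?S| <o |Pow I|"
    using ordLeq_ordLess_trans [OF card_of_finite_subsets [OF inf(1)] card_of_Pow] .
  obtain G H where GH: "xor_closed G" "xor_closed H" "G \<subseteq> Pow I" "H \<subseteq> Pow I" "G \<inter> H = ?S"
    "\<And>A. A \<in> \<A> \<Longrightarrow> G \<inter> A \<noteq> {}" "\<And>A. A \<in> \<A> \<Longrightarrow> H \<inter> A \<noteq> {}"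
  proof (rule independent_selection [of "Pow I" ?S \<A>])
    show "xor_closed (Pow I)" by (auto simp: xor_closed_def)
    show "infinite A" if "A \<in> \<A>" for A
      using PowA [OF that] inf(2) card_of_ordLeq_finite by blast
    show "|?S| <o |A|" if "A \<in> \<A>" for A using ordLess_ordLeq_trans [OF S_less PowA [OF that]] .
    show "|\<A>| \<le>o |A|" if "A \<in> \<A>" for A using ordLeq_transitive [OF \<A>_le PowA [OF that]] .
  qed (use xor_closed_finite_subsets subA in auto)
  have pc: "pseudocompact_space (subtopology cantor_topology K)"
    if K: "K \<subseteq> Pow I" "\<And>A. A \<in> \<A> \<Longrightarrow> K \<inter> A \<noteq> {}" for K
  proof (rule pseudocompact_cantor_subtopology [OF K(1)])
    fix J y :: "'a set" assume J: "countable J" and y: "y \<subseteq> I"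
    \<comment> \<open>Coordinates of \<open>J\<close> outside \<open>I\<close> impose nothing, since
      \<open>x\<close> and \<open>y\<close> are both subsets of \<open>I\<close>.\<close>
    then have "Pow I \<inter> cylinder y (J \<inter> I) \<in> \<A>" unfolding \<A>_def \<C>_def by auto
    then obtain x where x: "x \<in> K" "x \<subseteq> I" "x \<in> cylinder y (J \<inter> I)" using K(2) by blast
    then have "x \<in> cylinder y J" using y unfolding cylinder_def by blast
    then show "\<exists>x\<in>K. x \<in> cylinder y J" using x(1) by blast
  qed
  have sep: "separable_space (subtopology cantor_topology C)"
    if K: "K \<subseteq> Pow I" "\<And>A. A \<in> \<A> \<Longrightarrow> K \<inter> A \<noteq> {}"
      and C: "C \<subseteq> K" "xor_closed C" "closedin (subtopology cantor_topology K) C" for K C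
  proof (rule closed_subgroup_separable [OF K(1) _ C])
    fix N assume N: "N \<in> ?\<N>"
    have "K \<inter> B \<noteq> {}" if "B \<in> \<B> N" for B using K(2) N that unfolding \<A>_def by blast
    then show "\<exists>\<B>. countable \<B> \<and> (\<forall>B\<in>\<B>. B \<subseteq> N \<and> K \<inter> B \<noteq> {}) \<and>
          (\<forall>x\<in>N. \<forall>F. finite F \<longrightarrow> (\<exists>B\<in>\<B>. B \<subseteq> cylinder x F))"
      using \<B>(1) [OF N] \<B>(2) [OF N] \<B>(3) [OF N] by (intro exI [of _ "\<B> N"]) simp
  qed
  show thesis
    by (rule that [OF GH(1,2,5) pc [OF GH(3,6)] pc [OF GH(4,7)]])
      (use sep [OF GH(3,6)] sep [OF GH(4,7)] in simp_all)
qed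

section \<open>The diagonal subgroup of the product\<close>

text \<open>The diagonal map is continuous and carries the compact layers of sets of size at most
  \<open>n\<close> onto compact sets covering the diagonal.\<close>

lemma sigma_compact_diagonal:
  assumes "S \<subseteq> G" "S \<subseteq> H" and S: "S = {x. finite x \<and> x \<subseteq> I}"
  shows "sigma_compact_space (subtopology (prod_topology (subtopology cantor_topology G)
           (subtopology cantor_topology H)) ((\<lambda>x. (x, x)) ` S))"
proof -
  let ?P = "prod_topology (subtopology cantor_topology G) (subtopology cantor_topology H)"
  let ?K = "\<lambda>n. {x. x \<subseteq> I \<and> finite x \<and> card x \<le> n}"
  have "continuous_map (subtopology cantor_topology S) (subtopology cantor_topology A) (\<lambda>x. x)"
    if "S \<subseteq> A" for A
    using that by (auto simp: continuous_map_in_subtopology)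
  then have cm: "continuous_map (subtopology cantor_topology S) ?P (\<lambda>x. (x, x))"
    using assms by (simp add: continuous_map_pairedI)
  have KS: "?K n \<subseteq> S" for n using S by auto
  have "compactin (subtopology ?P ((\<lambda>x. (x, x)) ` S)) ((\<lambda>x. (x, x)) ` ?K n)" for n
  proof -
    have "compactin (subtopology cantor_topology S) (?K n)"
      using KS compactin_cantor_card_le by (simp add: compactin_subtopology)
    then have "compactin ?P ((\<lambda>x. (x, x)) ` ?K n)" using cm by (rule image_compactin)
    then show ?thesis using KS by (simp add: compactin_subtopology image_mono)
  qed
  moreover have "\<Union>(range (\<lambda>n. (\<lambda>x. (x, x)) ` ?K n)) = topspace (subtopology ?P ((\<lambda>x. (x, x)) ` S))"
    using assms by auto
  ultimately show ?thesis
    unfolding sigma_compact_space_def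
    by (intro exI [of _ "range (\<lambda>n. (\<lambda>x. (x, x)) ` ?K n)"]) auto
qed

text \<open>The first projection maps the diagonal continuously onto \<open>S\<close>, and
  separability passes to continuous images.\<close>

lemma not_separable_diagonal:
  assumes "S \<subseteq> G" "S \<subseteq> H" and S: "S = {x. finite x \<and> x \<subseteq> I}" and "uncountable I"
  shows "\<not> separable_space (subtopology (prod_topology (subtopology cantor_topology G)
           (subtopology cantor_topology H)) ((\<lambda>x. (x, x)) ` S))"
proof
  let ?X = "subtopology (prod_topology (subtopology cantor_topology G)
           (subtopology cantor_topology H)) ((\<lambda>x. (x, x)) ` S)"
  assume sep: "separable_space ?X"
  have "continuous_map ?X (subtopology cantor_topology G) fst"
    by (simp add: continuous_map_fst continuous_map_from_subtopology)
  then have "continuous_map ?X (subtopology cantor_topology S) fst"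
    by (auto simp: continuous_map_in_subtopology)
  moreover have "fst ` topspace ?X = topspace (subtopology cantor_topology S)"
    using assms(1,2) by force
  ultimately have "separable_space (subtopology cantor_topology S)"
    using sep by (meson separable_space_continuous_map_image)
  then show False using not_separable_finite_subsets [OF assms(4)] S by simp
qed

text \<open>The set is the trace on \<open>G \<times> H\<close> of the full diagonal, which is
  closed because the cube is Hausdorff.\<close>

lemma closedin_diagonal:
  assumes "S = G \<inter> H"
  shows "closedin (prod_topology (subtopology cantor_topology G) (subtopology cantor_topology H))
           ((\<lambda>x. (x, x)) ` S)"
proof -
  let ?P = "prod_topology (subtopology cantor_topology G) (subtopology cantor_topology H)"
  have "closedin (prod_topology cantor_topology cantor_topology) ((\<lambda>x. (x, x)) ` UNIV)"
    using Hausdorff_cantor by (simp add: Hausdorff_space_closedin_diagonal)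
  then have "closedin (subtopology (prod_topology cantor_topology cantor_topology) (G \<times> H))
      ((\<lambda>x. (x, x)) ` UNIV \<inter> (G \<times> H))"
    by (auto simp: closedin_subtopology)
  moreover have "(\<lambda>x. (x, x)) ` UNIV \<inter> (G \<times> H) = (\<lambda>x. (x, x)) ` S"
    using assms by auto
  ultimately show ?thesis by (simp add: subtopology_Times)
qed

lemma subgroup_diagonal:
  assumes "xor_closed G" "xor_closed H" "S = G \<inter> H"
  shows "subgroup ((\<lambda>x. (x, x)) ` S) (xor_group G \<times>\<times> xor_group H)"
proof -
  have grp: "group (xor_group G)" "group (xor_group H)"
    using assms comm_group_xor_group by (auto simp: comm_group_def)
  show ?thesis
  proof (rule subgroup.intro)
    fix p assume "p \<in> (\<lambda>x. (x, x)) ` S"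
    then obtain x where x: "p = (x, x)" "x \<in> S" by blast
    then have "inv\<^bsub>xor_group G \<times>\<times> xor_group H\<^esub> p = p"
      using assms grp by (simp add: inv_DirProd inv_xor_group)
    then show "inv\<^bsub>xor_group G \<times>\<times> xor_group H\<^esub> p \<in> (\<lambda>x. (x, x)) ` S" using x by simp
  qed (use assms in \<open>auto simp: xor_closed_def\<close>)
qed

section \<open>The index set and the conclusion\<close>

text \<open>\<open>cardSuc natLeq\<close> is \<omega>_1, which is at most the cardinality of the
  uncountable set of reals and so is realised by a set of reals. Reals serve as coordinates because
  their topology is second countable and T1, as the \<pi>-network requires.\<close>

lemma uncountable_real_set_small_Pow:
  assumes "ctwo ^c cardSuc natLeq =o ctwo ^c natLeq"
  obtains I :: "real set" where "uncountable I" "|Pow I| \<le>o |UNIV :: nat set set|"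
proof -
  have pow: "ctwo ^c |A| =o |Pow A|" for A :: "'b set"
    unfolding cexp_def ctwo_def Field_card_of
    using card_of_Pow_Func ordIso_symmetric by blast
  have co: "Card_order (cardSuc natLeq)" using natLeq_Card_order by (rule cardSuc_Card_order)
  have "\<not> |UNIV :: real set| \<le>o natLeq"
    using uncountable_UNIV_real by (meson countable_iff_natLeq)
  then have "natLeq <o |UNIV :: real set|"
    using natLeq_Well_order card_of_Well_order not_ordLeq_iff_ordLess by blast
  then have "cardSuc natLeq \<le>o |UNIV :: real set|"
    using cardSuc_ordLess_ordLeq [OF natLeq_Card_order card_of_Card_order] by blast
  then obtain I :: "real set" where I: "cardSuc natLeq =o |I|"
    using internalize_card_of_ordLeq2 [of "Field (cardSuc natLeq)"] card_of_Field_ordIso [OF co]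
    by (meson ordIso_ordLeq_trans ordIso_symmetric ordIso_transitive)
  have "natLeq <o |I|"
    using ordLess_ordIso_trans [OF cardSuc_greater [OF natLeq_Card_order] I] .
  then have "uncountable I"
    using countable_iff_natLeq not_ordLess_ordLeq by blast
  moreover have "|Pow I| \<le>o |UNIV :: nat set set|"
  proof -
    have "|Pow I| =o ctwo ^c |I|" using pow ordIso_symmetric by blast
    also have "ctwo ^c |I| =o ctwo ^c cardSuc natLeq"
      using co by (intro cexp_cong2 ordIso_symmetric [OF I] Card_order_ctwo card_of_Card_order)
    also note assms
    also have "ctwo ^c natLeq =o ctwo ^c |UNIV :: nat set|"
      by (intro cexp_cong2 ordIso_symmetric [OF card_of_nat] Card_order_ctwo card_of_Card_order
          natLeq_Card_order)
    also note pow
    finally show ?thesis unfolding Pow_UNIV by (rule ordIso_imp_ordLeq)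
  qed
  ultimately show thesis by (rule that)
qed

theorem theorem3p4:
  assumes "ctwo ^c cardSuc natLeq =o ctwo ^c natLeq"
  shows "\<exists>(G :: real set monoid) (H :: real set monoid) TG TH.
      comm_group G \<and> topological_group G TG \<and> pseudocompact_space TG \<and>
      comm_group H \<and> topological_group H TH \<and> pseudocompact_space TH \<and>
      (\<forall>S. subgroup S G \<and> closedin TG S \<longrightarrow> separable_space (subtopology TG S)) \<and>
      (\<forall>S. subgroup S H \<and> closedin TH S \<longrightarrow> separable_space (subtopology TH S)) \<and>
      (\<exists>K. subgroup K (G \<times>\<times> H) \<and> closedin (prod_topology TG TH) K \<and>
           \<not> separable_space (subtopology (prod_topology TG TH) K) \<and>
           sigma_compact_space (subtopology (prod_topology TG TH) K))"
proof -
  obtain I :: "real set" where I: "uncountable I" "|Pow I| \<le>o |UNIV :: nat set set|"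
    using uncountable_real_set_small_Pow [OF assms] .
  obtain G H where GH: "xor_closed G" "xor_closed H" "G \<inter> H = {x. finite x \<and> x \<subseteq> I}"
    and pc: "pseudocompact_space (subtopology cantor_topology G)"
      "pseudocompact_space (subtopology cantor_topology H)"
    and sep: "\<forall>C. C \<subseteq> G \<and> xor_closed C \<and> closedin (subtopology cantor_topology G) C \<longrightarrow>
        separable_space (subtopology cantor_topology C)"
      "\<forall>C. C \<subseteq> H \<and> xor_closed C \<and> closedin (subtopology cantor_topology H) C \<longrightarrow>
        separable_space (subtopology cantor_topology C)"
    by (rule pseudocompact_pair [OF I])
  \<comment> \<open>By the choice of \<open>G\<close> and \<open>H\<close>, this is the diagonal
    copy of the group of finite subsets of \<open>I\<close>.\<close>
  define K where "K = (\<lambda>x. (x, x)) ` (G \<inter> H)"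
  let ?TG = "subtopology cantor_topology G" and ?TH = "subtopology cantor_topology H"
  have "separable_space (subtopology ?TG S)" if "subgroup S (xor_group G)" "closedin ?TG S" for S
    using that sep(1) GH(1) by (simp add: subgroup_xor_group subtopology_subtopology Int_absorb1)
  moreover have "separable_space (subtopology ?TH S)" if "subgroup S (xor_group H)" "closedin ?TH S" for S
    using that sep(2) GH(2) by (simp add: subgroup_xor_group subtopology_subtopology Int_absorb1)
  moreover have "subgroup K (xor_group G \<times>\<times> xor_group H)"
    unfolding K_def using GH by (intro subgroup_diagonal) auto
  moreover have "closedin (prod_topology ?TG ?TH) K"
    unfolding K_def by (rule closedin_diagonal) simp
  moreover have "\<not> separable_space (subtopology (prod_topology ?TG ?TH) K)"
    unfolding K_def by (rule not_separable_diagonal [OF _ _ GH(3) I(1)]) auto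
  moreover have "sigma_compact_space (subtopology (prod_topology ?TG ?TH) K)"
    unfolding K_def by (rule sigma_compact_diagonal [OF _ _ GH(3)]) auto
  ultimately show ?thesis
    using pc comm_group_xor_group [OF GH(1)] comm_group_xor_group [OF GH(2)]
      topological_group_xor_group [OF GH(1)] topological_group_xor_group [OF GH(2)]
    by (intro exI [of _ "xor_group G"] exI [of _ "xor_group H"] exI [of _ ?TG] exI [of _ ?TH] conjI) blast+
qed

end
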